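(* Let $\alpha\in(0,1)$, let $B\subset\mathbb{R}^n$ be a ball of radius $r$ and let $\psi\in L^\infty(B)$ be non-negative with $\|\psi\|_{L^1(B)}=1$ and $\|\psi\|_{L^\infty(B)}\le c_0r^{-n}$. Then there is a constant $C$ depending only on $n$ and $c_0$ such that for all $v\in L^1(B)$ and every Lebesgue point $x\in\overline{B}$ of $v$, $$|v(x)-\langle v\rangle_\psi|\le C(1-\alpha)\int_B\int_B\frac{|v(\zeta)-v(z)|}{|\zeta-z|^{n+\alpha}(|x-z|+|x-\zeta|)^{n-\alpha}}\,d\zeta\,dz\le C(1-\alpha)\int_B\int_B\frac{|v(\zeta)-v(z)|}{|\zeta-z|^{n+\alpha}}\,d\zeta\,\frac{1}{|x-z|^{n-\alpha}}\,dz,$$ where $\langle v\rangle_\psi=\int_B v\,\psi\,dx$.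
   Context: Throughout $n\ge2$. A point $x\in\overline B$ is a Lebesgue point of $v\in L^1(B)$ with value $v(x)$ if $\lim_{\rho\to0}\frac{1}{|B_\rho(x)\cap B|}\int_{B_\rho(x)\cap B}|v(y)-v(x)|\,dy=0$, where $B_\rho(x)$ is the ball of center $x$ and radius $\rho$. *)

theory Defs
  imports "HOL-Analysis.Analysis" "HOL-Probability.Essential_Supremum"
begin

text \<open>
  The value \<open>a\<close> at the Lebesgue point is an explicit argument, because an element of
  \<open>L\<^sup>1(B)\<close> has no prescribed pointwise values and \<open>x\<close> may lie on the boundary of \<open>B\<close>.
\<close>

definition lebesgue_point :: "(real^'n) set \<Rightarrow> (real^'n \<Rightarrow> real) \<Rightarrow> real^'n \<Rightarrow> real \<Rightarrow> bool" where
  "lebesgue_point B v x a \<longleftrightarrow>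
     set_integrable lebesgue B v \<and> x \<in> closure B \<and>
     ((\<lambda>\<rho>. (LINT y:(ball x \<rho> \<inter> B)|lebesgue. \<bar>v y - a\<bar>) / measure lebesgue (ball x \<rho> \<inter> B))
        \<longlongrightarrow> 0) (at_right 0)"

definition L1_norm :: "(real^'n) set \<Rightarrow> (real^'n \<Rightarrow> real) \<Rightarrow> ennreal" where
  "L1_norm B f = (\<integral>\<^sup>+x\<in>B. ennreal \<bar>f x\<bar> \<partial>lebesgue)"

definition Linf_norm :: "(real^'n) set \<Rightarrow> (real^'n \<Rightarrow> real) \<Rightarrow> ereal" where
  "Linf_norm B f = esssup (lebesgue_on B) (\<lambda>x. ereal \<bar>f x\<bar>)"

definition in_Linf :: "(real^'n) set \<Rightarrow> (real^'n \<Rightarrow> real) \<Rightarrow> bool" where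
  "in_Linf B f \<longleftrightarrow> f \<in> borel_measurable (lebesgue_on B) \<and> Linf_norm B f < \<infinity>"

definition weighted_mean :: "(real^'n) set \<Rightarrow> (real^'n \<Rightarrow> real) \<Rightarrow> (real^'n \<Rightarrow> real) \<Rightarrow> real" where
  "weighted_mean B \<psi> v = (LINT y:B|lebesgue. v y * \<psi> y)"

text \<open>
  Both double integrals may be infinite, so they take values in \<^typ>\<open>ennreal\<close>. The conventions
  \<open>0 powr s = 0\<close> and \<open>t / 0 = 0\<close> only affect the integrands where \<open>\<zeta> = z\<close> (where the
  numerator vanishes) and where \<open>z = x\<close>, which is a null set.
\<close>

definition double_kernel_integral ::
    "(real^'n) set \<Rightarrow> real \<Rightarrow> (real^'n \<Rightarrow> real) \<Rightarrow> real^'n \<Rightarrow> ennreal" where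
  "double_kernel_integral B \<alpha> v x =
     (\<integral>\<^sup>+z\<in>B. (\<integral>\<^sup>+\<zeta>\<in>B.
        ennreal (\<bar>v \<zeta> - v z\<bar> /
          (norm (\<zeta> - z) powr (real CARD('n) + \<alpha>) *
           (norm (x - z) + norm (x - \<zeta>)) powr (real CARD('n) - \<alpha>))) \<partial>lebesgue) \<partial>lebesgue)"

definition riesz_kernel_integral ::
    "(real^'n) set \<Rightarrow> real \<Rightarrow> (real^'n \<Rightarrow> real) \<Rightarrow> real^'n \<Rightarrow> ennreal" where
  "riesz_kernel_integral B \<alpha> v x =
     (\<integral>\<^sup>+z\<in>B. (\<integral>\<^sup>+\<zeta>\<in>B.
        ennreal (\<bar>v \<zeta> - v z\<bar> / norm (\<zeta> - z) powr (real CARD('n) + \<alpha>)) \<partial>lebesgue) *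
        ennreal (1 / norm (x - z) powr (real CARD('n) - \<alpha>)) \<partial>lebesgue)"

end

theory Submission
  imports Defs
begin

text \<open>
  Let \<open>n\<close> be the dimension and let \<open>B\<^sub>k\<close> be the image of the ball \<open>B\<close> under the dilation with centre
  \<open>x\<close> and ratio \<open>2 ^ (-k)\<close>. Since \<open>x\<close> is in the closure of \<open>B\<close> and \<open>B\<close> is convex, the balls \<open>B\<^sub>k\<close>
  decrease, stay in \<open>B\<close> and fill a fixed fraction of \<open>ball x (2 * r / 2 ^ k) \<inter> B\<close>; hence the averages
  of \<open>v\<close> over \<open>B\<^sub>k\<close> tend to the value at the Lebesgue point (\<open>average_shrunk_ball_tendsto\<close>). The
  difference of two consecutive averages is at most a constant times the mean of \<open>\<bar>v \<zeta> - v z\<bar>\<close> over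
  \<open>B\<^sub>k \<times> B\<^sub>k\<close>, and so is the difference of the weighted mean and the average over \<open>B\<^sub>0 = B\<close>, because
  the weight is bounded by \<open>c0 / r ^ n\<close>.

  To gain the kernel \<open>norm (\<zeta> - z) powr -(n + \<alpha>)\<close> together with the factor \<open>1 - \<alpha>\<close>, let \<open>J h\<close> be the
  integral of \<open>\<bar>v (z + h) - v z\<bar>\<close> over all \<open>z\<close> such that \<open>z\<close> and \<open>z + h\<close> are in \<open>B\<^sub>k\<close>. Inserting the
  midpoint gives \<open>J h \<le> 2 * J (h / 2)\<close>, so that the oscillation of \<open>v\<close> is seen at every smaller dyadic
  scale \<open>2 ^ (-j)\<close> with weight \<open>2 ^ (-j * (1 - \<alpha>))\<close>. The sum of these weights is at least
  \<open>1 / (1 - \<alpha>)\<close>, which is the fractional Poincare inequality \<open>fractional_poincare_convex\<close>.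

  After this inequality the \<open>k\<close>-th term of the telescoping sum carries the weight
  \<open>(2 ^ k / r) powr (n - \<alpha>)\<close> on \<open>B\<^sub>k \<times> B\<^sub>k\<close>. For fixed \<open>z\<close> and \<open>\<zeta>\<close> only those \<open>k\<close> occur for which
  \<open>2 ^ k\<close> is at most \<open>4 * r / (norm (x - z) + norm (x - \<zeta>))\<close>, and the geometric sum over them is
  dominated by its last term, which is the second factor of the kernel
  (\<open>sum_shrunk_balls_le_kernel\<close>).
\<close>

section \<open>Dyadic sums\<close>
text \<open>
  A geometric sum with ratio at least \<open>2\<close> is controlled by its last term. The second bound in the
  minimum is what keeps the induction going as long as \<open>2 ^ N < X\<close>.
\<close>
lemma sum_dyadic_below:
  fixes \<beta> X :: real
  assumes "1 \<le> \<beta>" "0 < X"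
  shows "(\<Sum>k<N. if 2 ^ k < X then (2 ^ k) powr \<beta> else 0) \<le> min (2 * X powr \<beta>) ((2 ^ N) powr \<beta>)"
proof (induction N)
  case 0
  then show ?case by simp
next
  case (Suc N)
  have "2 powr 1 \<le> (2::real) powr \<beta>"
    using assms by (intro powr_mono) auto
  then have dbl: "2 * (2 ^ N) powr \<beta> \<le> (2 ^ Suc N) powr \<beta>"
    by (simp add: powr_mult mult_right_mono)
  show ?case
  proof (cases "2 ^ N < X")
    case True
    then have "(2 ^ N) powr \<beta> \<le> X powr \<beta>"
      using assms by (intro powr_mono2) auto
    with Suc dbl True show ?thesis by simp
  next
    case False
    have "(2 ^ N :: real) powr \<beta> \<le> (2 ^ Suc N) powr \<beta>"
      using assms by (intro powr_mono2) auto
    with Suc False show ?thesis by auto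
  qed
qed

lemma suminf_dyadic_below:
  fixes \<beta> X :: real
  assumes "1 \<le> \<beta>" "0 < X"
  shows "(\<Sum>k. ennreal (if 2 ^ k < X then (2 ^ k) powr \<beta> else 0)) \<le> ennreal (2 * X powr \<beta>)"
proof (rule suminf_le_const)
  show "summable (\<lambda>k. ennreal (if 2 ^ k < X then (2 ^ k) powr \<beta> else 0))" by simp
  fix N
  have "(\<Sum>k<N. ennreal (if 2 ^ k < X then (2 ^ k) powr \<beta> else 0))
      = ennreal (\<Sum>k<N. if 2 ^ k < X then (2 ^ k) powr \<beta> else 0)"
    by (intro sum_ennreal) auto
  also have "\<dots> \<le> ennreal (2 * X powr \<beta>)"
    using sum_dyadic_below[OF assms, of N] by (intro ennreal_leI) simp
  finally show "(\<Sum>k<N. ennreal (if 2 ^ k < X then (2 ^ k) powr \<beta> else 0)) \<le> ennreal (2 * X powr \<beta>)" .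
qed

text \<open>
  This is the source of the factor \<open>1 - \<alpha>\<close>: the weights form a geometric series with ratio
  \<open>q = 2 powr (\<alpha> - 1)\<close>, and convexity of the exponential gives \<open>1 - q \<le> (1 - \<alpha>) * ln 2 \<le> 1 - \<alpha>\<close>.
\<close>
lemma suminf_dyadic_weights_ge:
  fixes \<alpha> :: real
  assumes "\<alpha> < 1"
  shows "1 \<le> ennreal (1 - \<alpha>) * (\<Sum>j. ennreal ((2 ^ j) powr (\<alpha> - 1)))"
proof -
  define q :: real where "q = 2 powr (\<alpha> - 1)"
  have q: "0 < q" "q < 1"
    using assms powr_less_mono[of "\<alpha> - 1" 0 "2::real"] by (auto simp: q_def)
  have powr_q: "(2 ^ j) powr (\<alpha> - 1) = q ^ j" for j :: nat
    unfolding q_def by (simp add: powr_realpow [symmetric] powr_powr mult.commute)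
  have "1 - q \<le> 1 - \<alpha>"
  proof -
    have "1 + (\<alpha> - 1) * ln 2 \<le> q"
      unfolding q_def powr_def using exp_ge_add_one_self[of "(\<alpha> - 1) * ln 2"] by simp
    moreover have "(1 - \<alpha>) * ln 2 \<le> (1 - \<alpha>) * 1"
      using assms ln_2_less_1 by (intro mult_left_mono) auto
    ultimately show ?thesis by (simp add: algebra_simps)
  qed
  then have "1 \<le> (1 - \<alpha>) * (1 / (1 - q))"
    using q by (simp add: field_simps)
  then have "1 \<le> ennreal ((1 - \<alpha>) * (1 / (1 - q)))"
    by (metis ennreal_1 ennreal_leI)
  also have "\<dots> = ennreal (1 - \<alpha>) * ennreal (1 / (1 - q))"
    using assms q by (intro ennreal_mult) auto
  also have "ennreal (1 / (1 - q)) = (\<Sum>j. ennreal (q ^ j))"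
    using q geometric_sums[of q] by (intro suminf_ennreal_eq[symmetric]) auto
  finally show ?thesis by (simp add: powr_q)
qed

section \<open>Fractional Poincare inequality on convex sets\<close>
lemma nn_integral_lborel_translate:
  fixes f :: "'a::euclidean_space \<Rightarrow> ennreal"
  assumes [measurable]: "f \<in> borel_measurable borel"
  shows "(\<integral>\<^sup>+x. f (t + x) \<partial>lborel) = (\<integral>\<^sup>+x. f x \<partial>lborel)"
  by (subst (2) lborel_distr_plus[symmetric, of t]) (simp add: nn_integral_distr)

lemma nn_integral_lborel_dilate:
  fixes f :: "'a::euclidean_space \<Rightarrow> ennreal"
  assumes [measurable]: "f \<in> borel_measurable borel" and "c \<noteq> 0"
  shows "(\<integral>\<^sup>+x. f x \<partial>lborel) = ennreal (\<bar>c\<bar> ^ DIM('a)) * (\<integral>\<^sup>+x. f (c *\<^sub>R x) \<partial>lborel)"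
  by (subst lborel_affine[OF \<open>c \<noteq> 0\<close>, of 0])
     (simp add: nn_integral_density nn_integral_distr nn_integral_cmult ennreal_power)

text \<open>
  The \<open>L\<^sup>1\<close> modulus of continuity of \<open>g\<close> on \<open>D\<close> in the direction \<open>h\<close>; pairs that leave \<open>D\<close> do not
  count, so that for convex \<open>D\<close> the midpoint of an admissible pair is admissible with both ends.
\<close>
definition increment_integral :: "'a::euclidean_space set \<Rightarrow> ('a \<Rightarrow> real) \<Rightarrow> 'a \<Rightarrow> ennreal" where
  "increment_integral D g h =
     (\<integral>\<^sup>+z. ennreal \<bar>g (z + h) - g z\<bar> * indicator D z * indicator D (z + h) \<partial>lborel)"

lemma measurable_increment_integral [measurable]:
  fixes g :: "'a::euclidean_space \<Rightarrow> real"
  assumes [measurable]: "g \<in> borel_measurable borel" "D \<in> sets borel"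
  shows "increment_integral D g \<in> borel_measurable borel"
  unfolding increment_integral_def by measurable

text \<open>
  Substituting \<open>\<zeta> = z + h\<close> and exchanging the order of integration turns a double integral with a
  translation invariant weight into a single integral over the increment \<open>h\<close>.
\<close>
lemma double_integral_eq_increment_integral:
  fixes g :: "'a::euclidean_space \<Rightarrow> real"
  assumes [measurable]: "g \<in> borel_measurable borel" "D \<in> sets borel" "\<phi> \<in> borel_measurable borel"
  shows "(\<integral>\<^sup>+z\<in>D. (\<integral>\<^sup>+\<zeta>\<in>D. ennreal \<bar>g \<zeta> - g z\<bar> * \<phi> (\<zeta> - z) \<partial>lborel) \<partial>lborel)
       = (\<integral>\<^sup>+h. increment_integral D g h * \<phi> h \<partial>lborel)"
proof -
  let ?F = "\<lambda>h z. ennreal \<bar>g (z + h) - g z\<bar> * indicator D z * indicator D (z + h) * \<phi> h"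
  have "(\<integral>\<^sup>+z\<in>D. (\<integral>\<^sup>+\<zeta>\<in>D. ennreal \<bar>g \<zeta> - g z\<bar> * \<phi> (\<zeta> - z) \<partial>lborel) \<partial>lborel)
      = (\<integral>\<^sup>+z. (\<integral>\<^sup>+h. ?F h z \<partial>lborel) \<partial>lborel)"
  proof (rule nn_integral_cong)
    fix z
    have "(\<integral>\<^sup>+\<zeta>\<in>D. ennreal \<bar>g \<zeta> - g z\<bar> * \<phi> (\<zeta> - z) \<partial>lborel) * indicator D z
        = (\<integral>\<^sup>+\<zeta>. ennreal \<bar>g \<zeta> - g z\<bar> * \<phi> (\<zeta> - z) * indicator D \<zeta> * indicator D z \<partial>lborel)"
      by (intro nn_integral_multc[symmetric]) measurable
    also have "\<dots> = (\<integral>\<^sup>+h. ennreal \<bar>g (z + h) - g z\<bar> * \<phi> (z + h - z) * indicator D (z + h) * indicator D z \<partial>lborel)"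
      by (intro nn_integral_lborel_translate[symmetric]) measurable
    also have "\<dots> = (\<integral>\<^sup>+h. ?F h z \<partial>lborel)"
      by (simp add: mult_ac)
    finally show "(\<integral>\<^sup>+\<zeta>\<in>D. ennreal \<bar>g \<zeta> - g z\<bar> * \<phi> (\<zeta> - z) \<partial>lborel) * indicator D z = \<dots>" .
  qed
  also have "\<dots> = (\<integral>\<^sup>+h. (\<integral>\<^sup>+z. ?F h z \<partial>lborel) \<partial>lborel)"
    by (intro lborel_pair.Fubini') measurable
  also have "\<dots> = (\<integral>\<^sup>+h. increment_integral D g h * \<phi> h \<partial>lborel)"
    unfolding increment_integral_def by (intro nn_integral_cong nn_integral_multc) measurable
  finally show ?thesis .
qed

text \<open>
  Insert the midpoint \<open>z + h/2\<close>, which lies in \<open>D\<close> by convexity; the two halves have the same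
  integral because one is a translate of the other.
\<close>
lemma increment_integral_halve:
  fixes g :: "'a::euclidean_space \<Rightarrow> real"
  assumes "convex D" and [measurable]: "g \<in> borel_measurable borel" "D \<in> sets borel"
  shows "increment_integral D g h \<le> 2 * increment_integral D g ((1/2) *\<^sub>R h)"
proof -
  let ?k = "(1/2) *\<^sub>R h"
  let ?f = "\<lambda>z. ennreal \<bar>g (z + ?k) - g z\<bar> * indicator D z * indicator D (z + ?k)"
  have "increment_integral D g h \<le> (\<integral>\<^sup>+z. ?f (?k + z) + ?f z \<partial>lborel)"
    unfolding increment_integral_def
  proof (rule nn_integral_mono)
    fix z
    have h: "z + h = ?k + z + ?k" by (simp add: scaleR_left_distrib[symmetric])
    show "ennreal \<bar>g (z + h) - g z\<bar> * indicator D z * indicator D (z + h) \<le> ?f (?k + z) + ?f z"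
    proof (cases "z \<in> D \<and> z + h \<in> D")
      case True
      have "?k + z = (1/2) *\<^sub>R z + (1/2) *\<^sub>R (z + h)"
        by (simp add: algebra_simps scaleR_left_distrib[symmetric])
      also have "\<dots> \<in> D"
        using True \<open>convex D\<close> by (intro convexD) auto
      finally have mid: "?k + z \<in> D" "z + ?k \<in> D" by (simp_all add: add.commute)
      have "?k + z + ?k \<in> D" "z \<in> D" using True by (simp_all only: h[symmetric])
      moreover have "ennreal \<bar>g (z + h) - g z\<bar>
          \<le> ennreal (\<bar>g (?k + z + ?k) - g (?k + z)\<bar> + \<bar>g (z + ?k) - g z\<bar>)"
        unfolding h by (intro ennreal_leI) (simp add: add.commute)
      ultimately show ?thesis
        using True mid by simp
    qed auto
  qed
  also have "\<dots> = (\<integral>\<^sup>+z. ?f (?k + z) \<partial>lborel) + (\<integral>\<^sup>+z. ?f z \<partial>lborel)"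
    by (intro nn_integral_add) measurable
  also have "(\<integral>\<^sup>+z. ?f (?k + z) \<partial>lborel) = (\<integral>\<^sup>+z. ?f z \<partial>lborel)"
    by (intro nn_integral_lborel_translate) measurable
  also have "(\<integral>\<^sup>+z. ?f z \<partial>lborel) + (\<integral>\<^sup>+z. ?f z \<partial>lborel) = 2 * increment_integral D g ?k"
    unfolding increment_integral_def by (simp add: mult_2)
  finally show ?thesis .
qed

lemma increment_integral_dyadic:
  fixes g :: "'a::euclidean_space \<Rightarrow> real"
  assumes "convex D" and [measurable]: "g \<in> borel_measurable borel" "D \<in> sets borel"
  shows "increment_integral D g h \<le> 2 ^ j * increment_integral D g ((1 / 2 ^ j) *\<^sub>R h)"
proof (induction j)
  case (Suc j)
  have "increment_integral D g h \<le> 2 ^ j * increment_integral D g ((1 / 2 ^ j) *\<^sub>R h)"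
    by (rule Suc)
  also have "\<dots> \<le> 2 ^ j * (2 * increment_integral D g ((1/2) *\<^sub>R (1 / 2 ^ j) *\<^sub>R h))"
    by (intro mult_left_mono increment_integral_halve assms) simp
  finally show ?case by (simp add: mult_ac)
qed simp

lemma increment_integral_eq_0:
  fixes g :: "'a::euclidean_space \<Rightarrow> real"
  assumes "\<And>z \<zeta>. z \<in> D \<Longrightarrow> \<zeta> \<in> D \<Longrightarrow> norm (\<zeta> - z) < L" and "h = 0 \<or> L \<le> norm h"
  shows "increment_integral D g h = 0"
proof -
  have zero: "ennreal \<bar>g (z + h) - g z\<bar> * indicator D z * indicator D (z + h) = 0" for z
    using assms(1)[of z "z + h"] assms(2) by (auto simp: indicator_def)
  show ?thesis unfolding increment_integral_def zero by simp
qed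

text \<open>
  A fractional Poincare inequality of Bourgain-Brezis-Mironescu type, in dimension \<open>n\<close>, with the sharp dependence on
  \<open>\<alpha>\<close> as \<open>\<alpha>\<close> tends to \<open>1\<close>. Each of the scales \<open>2 ^ (-j)\<close> controls the left-hand side: by
  \<open>increment_integral_dyadic\<close> and a dilation, the integral over \<open>norm h < L / 2 ^ j\<close>, multiplied by
  \<open>2 ^ (j * (n + 1))\<close>, is at least the whole. Giving scale \<open>j\<close> the weight \<open>2 ^ (- j * (1 - \<alpha>))\<close> and
  summing over \<open>j\<close>, the weights on the left add up to at least \<open>1 / (1 - \<alpha>)\<close>, while the factors
  \<open>2 ^ (j * (n + \<alpha>))\<close> over the scales \<open>2 ^ j < L / norm h\<close> on the right add up to the kernel, up to the
  constant of \<open>suminf_dyadic_below\<close>.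
\<close>
lemma fractional_poincare_convex:
  fixes g :: "'a::euclidean_space \<Rightarrow> real"
  assumes "convex D" and [measurable]: "D \<in> sets borel" "g \<in> borel_measurable borel"
    and diam: "\<And>z \<zeta>. z \<in> D \<Longrightarrow> \<zeta> \<in> D \<Longrightarrow> norm (\<zeta> - z) < L"
    and L: "0 < L" and \<alpha>: "0 < \<alpha>" "\<alpha> < 1"
  defines "\<beta> \<equiv> real DIM('a) + \<alpha>"
  shows "(\<integral>\<^sup>+z\<in>D. (\<integral>\<^sup>+\<zeta>\<in>D. ennreal \<bar>g \<zeta> - g z\<bar> \<partial>lborel) \<partial>lborel)
     \<le> ennreal ((1 - \<alpha>) * (2 * L powr \<beta>)) *
       (\<integral>\<^sup>+z\<in>D. (\<integral>\<^sup>+\<zeta>\<in>D. ennreal (\<bar>g \<zeta> - g z\<bar> / norm (\<zeta> - z) powr \<beta>) \<partial>lborel) \<partial>lborel)"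
    (is "?S \<le> _ * ?R")
proof -
  let ?J = "increment_integral D g"
  let ?\<kappa> = "\<lambda>h. ennreal (1 / norm h powr \<beta>)"
  let ?w = "\<lambda>j::nat. ennreal ((2 ^ j) powr (\<alpha> - 1))"
  let ?c = "\<lambda>(j::nat) h. if 2 ^ j < L / norm h then (2 ^ j) powr \<beta> else 0"
  have zero: "?J h = 0" if "h = 0 \<or> L \<le> norm h" for h
    using diam that by (rule increment_integral_eq_0)
  have \<beta>: "1 \<le> \<beta>" using \<alpha> by (simp add: \<beta>_def add_increasing2 Suc_leI)
  have S: "?S = (\<integral>\<^sup>+h. ?J h \<partial>lborel)"
    using double_integral_eq_increment_integral[of g D "\<lambda>_. 1"] by simp
  have R: "?R = (\<integral>\<^sup>+h. ?J h * ?\<kappa> h \<partial>lborel)"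
  proof -
    have "ennreal (\<bar>g \<zeta> - g z\<bar> / norm (\<zeta> - z) powr \<beta>) = ennreal \<bar>g \<zeta> - g z\<bar> * ?\<kappa> (\<zeta> - z)" for z \<zeta>
      by (simp add: ennreal_mult[symmetric])
    then show ?thesis
      using double_integral_eq_increment_integral[of g D ?\<kappa>] by simp
  qed
  have scale: "?w j * ?S \<le> (\<integral>\<^sup>+h. ?J h * ennreal (?c j h) \<partial>lborel)" for j
  proof -
    have "?S = (\<integral>\<^sup>+h. ?J h * indicator {h. norm h < L} h \<partial>lborel)"
      unfolding S using zero
      by (intro nn_integral_cong) (auto simp: indicator_def not_less)
    also have "\<dots> \<le> (\<integral>\<^sup>+h. 2 ^ j * (?J ((1 / 2 ^ j) *\<^sub>R h) * indicator {h. norm h < L} h) \<partial>lborel)"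
      using increment_integral_dyadic[OF \<open>convex D\<close>, of g _ j]
      by (intro nn_integral_mono) (auto simp: indicator_def)
    also have "\<dots> = 2 ^ j * (\<integral>\<^sup>+h. ?J ((1 / 2 ^ j) *\<^sub>R h) * indicator {h. norm h < L} h \<partial>lborel)"
      by (intro nn_integral_cmult) measurable
    also have "(\<integral>\<^sup>+h. ?J ((1 / 2 ^ j) *\<^sub>R h) * indicator {h. norm h < L} h \<partial>lborel)
        = ennreal ((2 ^ j) ^ DIM('a)) * (\<integral>\<^sup>+h. ?J h * indicator {h. norm h < L} (2 ^ j *\<^sub>R h) \<partial>lborel)"
      by (subst nn_integral_lborel_dilate[where c = "2 ^ j"]) auto
    also have "(\<integral>\<^sup>+h. ?J h * indicator {h. norm h < L} (2 ^ j *\<^sub>R h) \<partial>lborel)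
        = (\<integral>\<^sup>+h. ?J h * indicator {h. 2 ^ j < L / norm h} h \<partial>lborel)"
      \<comment> \<open>The two indicators differ only at \<open>h = 0\<close>, where the increment vanishes.\<close>
    proof (rule nn_integral_cong)
      fix h
      show "?J h * indicator {h. norm h < L} (2 ^ j *\<^sub>R h) = ?J h * indicator {h. 2 ^ j < L / norm h} h"
        using zero[of h] by (cases "h = 0") (simp_all add: indicator_def field_simps)
    qed
    finally have "?w j * ?S \<le> ?w j * (2 ^ j * (ennreal ((2 ^ j) ^ DIM('a)) *
        (\<integral>\<^sup>+h. ?J h * indicator {h. 2 ^ j < L / norm h} h \<partial>lborel)))"
      by (intro mult_left_mono) auto
    also have "\<dots> = ennreal ((2 ^ j) powr (\<alpha> - 1) * 2 ^ j * (2 ^ j) ^ DIM('a)) *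
        (\<integral>\<^sup>+h. ?J h * indicator {h. 2 ^ j < L / norm h} h \<partial>lborel)"
      by (simp add: ennreal_mult mult_ac ennreal_power[symmetric])
    also have "(2 ^ j) powr (\<alpha> - 1) * 2 ^ j * (2 ^ j) ^ DIM('a) = (2 ^ j :: real) powr \<beta>"
    proof -
      have "(2 ^ j) ^ DIM('a) = (2 ^ j :: real) powr real DIM('a)"
        by (rule powr_realpow[symmetric]) simp
      moreover have "(2 ^ j) powr (\<alpha> - 1) * 2 ^ j = (2 ^ j :: real) powr \<alpha>"
        using powr_add[of "2 ^ j :: real" "\<alpha> - 1" 1] by simp
      ultimately show ?thesis by (simp add: \<beta>_def powr_add)
    qed
    also have "ennreal ((2 ^ j) powr \<beta>) * (\<integral>\<^sup>+h. ?J h * indicator {h. 2 ^ j < L / norm h} h \<partial>lborel)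
        = (\<integral>\<^sup>+h. ennreal ((2 ^ j) powr \<beta>) * (?J h * indicator {h. 2 ^ j < L / norm h} h) \<partial>lborel)"
      by (intro nn_integral_cmult[symmetric]) measurable
    also have "\<dots> = (\<integral>\<^sup>+h. ?J h * ennreal (?c j h) \<partial>lborel)"
      by (intro nn_integral_cong) (auto simp: indicator_def mult_ac)
    finally show ?thesis .
  qed
  have "(\<Sum>j. ?w j) * ?S = (\<Sum>j. ?w j * ?S)"
    by simp
  also have "\<dots> \<le> (\<Sum>j. \<integral>\<^sup>+h. ?J h * ennreal (?c j h) \<partial>lborel)"
    by (intro suminf_le scale) auto
  also have "\<dots> = (\<integral>\<^sup>+h. (\<Sum>j. ?J h * ennreal (?c j h)) \<partial>lborel)"
    by (intro nn_integral_suminf[symmetric]) measurable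
  also have "\<dots> \<le> (\<integral>\<^sup>+h. ennreal (2 * L powr \<beta>) * (?J h * ?\<kappa> h) \<partial>lborel)"
  proof (rule nn_integral_mono)
    fix h
    show "(\<Sum>j. ?J h * ennreal (?c j h)) \<le> ennreal (2 * L powr \<beta>) * (?J h * ?\<kappa> h)"
    proof (cases "h = 0")
      case True
      then show ?thesis using zero[of h] by simp
    next
      case False
      have "(\<Sum>j. ?J h * ennreal (?c j h)) = ?J h * (\<Sum>j. ennreal (?c j h))"
        by simp
      also have "\<dots> \<le> ?J h * ennreal (2 * (L / norm h) powr \<beta>)"
        using \<beta> L False by (intro mult_left_mono suminf_dyadic_below) auto
      also have "2 * (L / norm h) powr \<beta> = 2 * L powr \<beta> * (1 / norm h powr \<beta>)"
        using L by (simp add: powr_divide)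
      also have "ennreal \<dots> = ennreal (2 * L powr \<beta>) * ?\<kappa> h"
        by (intro ennreal_mult) auto
      finally show ?thesis by (simp add: mult_ac)
    qed
  qed
  also have "\<dots> = ennreal (2 * L powr \<beta>) * ?R"
    unfolding R by (intro nn_integral_cmult) measurable
  finally have le: "(\<Sum>j. ?w j) * ?S \<le> ennreal (2 * L powr \<beta>) * ?R" .
  have "?S = 1 * ?S"
    by (rule mult_1[symmetric])
  also have "\<dots> \<le> ennreal (1 - \<alpha>) * (\<Sum>j. ?w j) * ?S"
    by (intro mult_right_mono suminf_dyadic_weights_ge \<alpha>) auto
  also have "\<dots> \<le> ennreal (1 - \<alpha>) * (ennreal (2 * L powr \<beta>) * ?R)"
    unfolding mult.assoc by (intro mult_left_mono le) auto
  also have "\<dots> = ennreal ((1 - \<alpha>) * (2 * L powr \<beta>)) * ?R"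
    using \<alpha> by (simp add: ennreal_mult mult_ac)
  finally show ?thesis .
qed

section \<open>Averages\<close>
text \<open>
  Since \<open>w\<close> has total mass \<open>1\<close>, the constant \<open>u\<close> can be moved under the integral.
\<close>
lemma weighted_average_deviation:
  fixes f w :: "'a \<Rightarrow> real"
  assumes [measurable]: "S \<in> sets M"
    and f: "set_integrable M S f"
    and w: "(\<lambda>x. indicator S x * w x) \<in> borel_measurable M"
    and bounds: "AE x in M. x \<in> S \<longrightarrow> 0 \<le> w x \<and> w x \<le> m"
    and total: "(\<integral>\<^sup>+x\<in>S. ennreal (w x) \<partial>M) = 1" and "0 \<le> m"
  shows "ennreal \<bar>u - (LINT x:S|M. f x * w x)\<bar> \<le> ennreal m * (\<integral>\<^sup>+x\<in>S. ennreal \<bar>u - f x\<bar> \<partial>M)"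
proof -
  define W where "W x = indicator S x * w x" for x
  define F where "F x = indicator S x * f x" for x
  have [measurable]: "W \<in> borel_measurable M" "F \<in> borel_measurable M"
    using w f by (auto simp: W_def [abs_def] F_def [abs_def] set_integrable_def)
  have W: "AE x in M. 0 \<le> W x \<and> W x \<le> m * indicator S x"
    using bounds by eventually_elim (auto simp: W_def indicator_def)
  have "(\<integral>\<^sup>+x. ennreal (W x) \<partial>M) = ennreal 1"
    using total by (simp add: W_def nn_integral_set_ennreal mult.commute)
  then have W1: "integrable M W" "integral\<^sup>L M W = 1"
    using W by (auto intro!: integrableI_nn_integral_finite simp: integral_eq_nn_integral)
  have "integrable M (\<lambda>x. m * F x)"
    using f by (intro integrable_mult_right) (simp add: F_def set_integrable_def)
  then have FW: "integrable M (\<lambda>x. F x * W x)"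
  proof (rule Bochner_Integration.integrable_bound)
    show "AE x in M. norm (F x * W x) \<le> norm (m * F x)"
      using W
    proof eventually_elim
      case (elim x)
      then have "\<bar>W x\<bar> \<le> m" using \<open>0 \<le> m\<close> by (cases "x \<in> S") auto
      then show ?case
        using \<open>0 \<le> m\<close> by (simp add: abs_mult mult.commute[of m] mult_left_mono)
    qed
  qed measurable
  have "(LINT x:S|M. f x * w x) = (\<integral>x. F x * W x \<partial>M)"
    unfolding set_lebesgue_integral_def F_def W_def
    by (intro Bochner_Integration.integral_cong) (auto simp: indicator_def)
  then have "u - (LINT x:S|M. f x * w x) = (\<integral>x. u * W x - F x * W x \<partial>M)"
    using W1 FW by simp
  then have "ennreal \<bar>u - (LINT x:S|M. f x * w x)\<bar> = ennreal (norm (\<integral>x. u * W x - F x * W x \<partial>M))"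
    by simp
  also have "\<dots> \<le> (\<integral>\<^sup>+x. ennreal (norm (u * W x - F x * W x)) \<partial>M)"
    using W1 FW by (intro integral_norm_bound_ennreal) auto
  also have "\<dots> \<le> (\<integral>\<^sup>+x. ennreal m * (ennreal \<bar>u - F x\<bar> * indicator S x) \<partial>M)"
  proof (rule nn_integral_mono_AE)
    show "AE x in M. ennreal (norm (u * W x - F x * W x))
        \<le> ennreal m * (ennreal \<bar>u - F x\<bar> * indicator S x)"
      using W
    proof eventually_elim
      case (elim x)
      have "norm (u * W x - F x * W x) = \<bar>W x\<bar> * \<bar>u - F x\<bar>"
        by (simp add: abs_mult[symmetric] algebra_simps)
      also have "\<dots> \<le> (m * indicator S x) * \<bar>u - F x\<bar>"
        using elim by (intro mult_right_mono) auto
      finally have "ennreal (norm (u * W x - F x * W x)) \<le> ennreal (m * indicator S x * \<bar>u - F x\<bar>)"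
        by (rule ennreal_leI)
      then show ?case
        using \<open>0 \<le> m\<close> by (cases "x \<in> S") (simp_all add: ennreal_mult)
    qed
  qed
  also have "\<dots> = ennreal m * (\<integral>\<^sup>+x. ennreal \<bar>u - F x\<bar> * indicator S x \<partial>M)"
    by (intro nn_integral_cmult) measurable
  also have "(\<integral>\<^sup>+x. ennreal \<bar>u - F x\<bar> * indicator S x \<partial>M) = (\<integral>\<^sup>+x\<in>S. ennreal \<bar>u - f x\<bar> \<partial>M)"
    by (intro nn_integral_cong) (auto simp: F_def indicator_def)
  finally show ?thesis .
qed

definition average :: "'a::euclidean_space set \<Rightarrow> ('a \<Rightarrow> real) \<Rightarrow> real" where
  "average S f = (LINT x:S|lborel. f x) / measure lborel S"

lemma average_deviation:
  fixes f :: "'a::euclidean_space \<Rightarrow> real"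
  assumes S: "S \<in> sets borel" "0 < measure lborel S" and f: "set_integrable lborel S f"
  shows "ennreal \<bar>u - average S f\<bar>
     \<le> ennreal (1 / measure lborel S) * (\<integral>\<^sup>+x\<in>S. ennreal \<bar>u - f x\<bar> \<partial>lborel)"
proof -
  let ?m = "1 / measure lborel S"
  have "emeasure lborel S = ennreal (measure lborel S)"
    using S(2) by (intro emeasure_eq_ennreal_measure) (auto simp: measure_def top_unique)
  then have "(\<integral>\<^sup>+x\<in>S. ennreal ?m \<partial>lborel) = ennreal (?m * measure lborel S)"
    using S by (subst ennreal_mult) (simp_all add: nn_integral_cmult_indicator)
  then have "(\<integral>\<^sup>+x\<in>S. ennreal ?m \<partial>lborel) = 1"
    using S(2) by simp
  then have "ennreal \<bar>u - (LINT x:S|lborel. f x * ?m)\<bar>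
      \<le> ennreal ?m * (\<integral>\<^sup>+x\<in>S. ennreal \<bar>u - f x\<bar> \<partial>lborel)"
    using S f by (intro weighted_average_deviation) auto
  then show ?thesis by (simp add: average_def)
qed

text \<open>
  The average over \<open>S\<close> differs from a number \<open>b\<close>, itself close to the values of \<open>g\<close> on \<open>T \<subseteq> S\<close>, by at
  most the double oscillation over \<open>S\<close>. It serves twice: for \<open>b\<close> the average over a smaller set, and
  for \<open>b\<close> a weighted mean over \<open>S\<close> itself.
\<close>
lemma average_diff_le:
  fixes g :: "'a::euclidean_space \<Rightarrow> real"
  assumes [measurable]: "g \<in> borel_measurable borel"
    and S [measurable]: "S \<in> sets borel" "0 < measure lborel S" "set_integrable lborel S g"
    and T [measurable]: "T \<in> sets borel"
    and t: "ennreal \<bar>average S g - b\<bar> \<le> ennreal m * (\<integral>\<^sup>+z\<in>T. ennreal \<bar>average S g - g z\<bar> \<partial>lborel)"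
    and "0 \<le> m" "T \<subseteq> S"
  shows "ennreal \<bar>average S g - b\<bar>
     \<le> ennreal (m / measure lborel S) * (\<integral>\<^sup>+z\<in>S. (\<integral>\<^sup>+\<zeta>\<in>S. ennreal \<bar>g \<zeta> - g z\<bar> \<partial>lborel) \<partial>lborel)"
proof -
  let ?I = "\<lambda>z. \<integral>\<^sup>+\<zeta>\<in>S. ennreal \<bar>g \<zeta> - g z\<bar> \<partial>lborel"
  let ?s = "1 / measure lborel S"
  have dev: "ennreal \<bar>average S g - g z\<bar> \<le> ennreal ?s * ?I z" for z
    using average_deviation[OF S(1) S(2) S(3), of "g z"]
    by (simp add: abs_minus_commute)
  note t
  also have "(\<integral>\<^sup>+z\<in>T. ennreal \<bar>average S g - g z\<bar> \<partial>lborel)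
      \<le> (\<integral>\<^sup>+z. ennreal ?s * (?I z * indicator S z) \<partial>lborel)"
    using dev \<open>T \<subseteq> S\<close> by (intro nn_integral_mono) (auto simp: indicator_def)
  also have "\<dots> = ennreal ?s * (\<integral>\<^sup>+z\<in>S. ?I z \<partial>lborel)"
    by (intro nn_integral_cmult) measurable
  finally have "ennreal \<bar>average S g - b\<bar> \<le> ennreal m * (ennreal ?s * (\<integral>\<^sup>+z\<in>S. ?I z \<partial>lborel))"
    by (simp add: mult_left_mono)
  also have "\<dots> = ennreal (m * ?s) * (\<integral>\<^sup>+z\<in>S. ?I z \<partial>lborel)"
    using \<open>0 \<le> m\<close> by (subst ennreal_mult) (simp_all add: mult.assoc)
  finally show ?thesis by simp
qed

lemma limit_deviation_le_suminf:
  fixes A :: "nat \<Rightarrow> real" and D :: "nat \<Rightarrow> ennreal"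
  assumes "A \<longlonglongrightarrow> a" and step: "\<And>k. ennreal \<bar>A k - A (Suc k)\<bar> \<le> D k"
  shows "ennreal \<bar>a - A 0\<bar> \<le> (\<Sum>k. D k)"
proof (rule LIMSEQ_le_const2)
  show "(\<lambda>N. ennreal \<bar>A N - A 0\<bar>) \<longlonglongrightarrow> ennreal \<bar>a - A 0\<bar>"
    using assms(1) by (intro tendsto_intros)
  have "ennreal \<bar>A N - A 0\<bar> \<le> (\<Sum>k<N. D k)" for N
  proof (induction N)
    case (Suc N)
    have "ennreal \<bar>A (Suc N) - A 0\<bar> \<le> ennreal (\<bar>A N - A 0\<bar> + \<bar>A N - A (Suc N)\<bar>)"
      by (intro ennreal_leI) simp
    also have "\<dots> = ennreal \<bar>A N - A 0\<bar> + ennreal \<bar>A N - A (Suc N)\<bar>"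
      by (intro ennreal_plus) auto
    also have "\<dots> \<le> (\<Sum>k<N. D k) + D N"
      by (intro add_mono Suc step)
    finally show ?case by simp
  qed simp
  then show "\<exists>N. \<forall>n\<ge>N. ennreal \<bar>A n - A 0\<bar> \<le> (\<Sum>k. D k)"
    by (meson order_trans sum_le_suminf summableI finite_lessThan zero_le)
qed

section \<open>Balls shrinking towards a point of the closure\<close>
text \<open>
  The image of \<open>ball c r\<close> under the dilation with centre \<open>x\<close> and ratio \<open>1 / 2 ^ k\<close>. When \<open>x\<close> lies on
  the boundary of the ball, these sets replace the concentric balls around \<open>x\<close>: they stay inside
  \<open>ball c r\<close> and keep being convex.
\<close>
definition shrunk_ball :: "'a::euclidean_space \<Rightarrow> 'a \<Rightarrow> real \<Rightarrow> nat \<Rightarrow> 'a set" where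
  "shrunk_ball x c r k = ball (x + (1 / 2 ^ k) *\<^sub>R (c - x)) (r / 2 ^ k)"

lemma shrunk_ball_0 [simp]: "shrunk_ball x c r 0 = ball c r"
  by (simp add: shrunk_ball_def)

lemma shrunk_ball_borel [measurable, simp]: "shrunk_ball x c r k \<in> sets borel"
  by (simp add: shrunk_ball_def)

lemma convex_shrunk_ball: "convex (shrunk_ball x c r k)"
  by (simp add: shrunk_ball_def)

lemma measure_shrunk_ball:
  fixes x :: "'a::euclidean_space"
  assumes "0 < r"
  shows "measure lborel (shrunk_ball x c r k) = unit_ball_vol (real DIM('a)) * (r / 2 ^ k) ^ DIM('a)"
  using assms by (simp add: shrunk_ball_def content_ball)

lemma shrunk_ball_Suc_subset:
  fixes x c :: "'a::euclidean_space"
  assumes "dist c x \<le> r"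
  shows "shrunk_ball x c r (Suc k) \<subseteq> shrunk_ball x c r k"
proof -
  let ?s = "1 / 2 ^ k :: real"
  have "(x + (?s / 2) *\<^sub>R (c - x)) - (x + ?s *\<^sub>R (c - x)) = - ((?s / 2) *\<^sub>R (c - x))"
    by (simp add: algebra_simps scaleR_left_distrib[symmetric])
  then have "dist (x + (?s / 2) *\<^sub>R (c - x)) (x + ?s *\<^sub>R (c - x)) = (?s / 2) * dist c x"
    by (simp add: dist_norm)
  also have "\<dots> \<le> (?s / 2) * r"
    using assms by (intro mult_left_mono) auto
  finally have "dist (x + (?s / 2) *\<^sub>R (c - x)) (x + ?s *\<^sub>R (c - x)) + r * ?s / 2 \<le> r * ?s"
    by (simp add: field_simps)
  then show ?thesis
    by (auto simp: shrunk_ball_def ball_subset_ball_iff algebra_simps)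
qed

lemma shrunk_ball_subset:
  fixes x c :: "'a::euclidean_space"
  assumes "dist c x \<le> r"
  shows "shrunk_ball x c r k \<subseteq> ball c r"
  using decseqD[OF decseq_SucI[of "shrunk_ball x c r"], of 0 k] shrunk_ball_Suc_subset[OF assms]
  by simp

lemma shrunk_ball_subset_ball_apex:
  fixes x c :: "'a::euclidean_space"
  assumes "dist c x \<le> r"
  shows "shrunk_ball x c r k \<subseteq> ball x (2 * r / 2 ^ k)"
proof
  fix z assume "z \<in> shrunk_ball x c r k"
  then have "dist (x + (1 / 2 ^ k) *\<^sub>R (c - x)) z < r / 2 ^ k"
    by (simp add: shrunk_ball_def)
  moreover have "dist x (x + (1 / 2 ^ k) *\<^sub>R (c - x)) \<le> r / 2 ^ k"
    using assms by (simp add: dist_norm divide_right_mono)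
  ultimately have "dist x z < r / 2 ^ k + r / 2 ^ k"
    using dist_triangle[of x z "x + (1 / 2 ^ k) *\<^sub>R (c - x)"] by linarith
  then show "z \<in> ball x (2 * r / 2 ^ k)" by simp
qed

lemma shrunk_ball_diameter:
  fixes x c :: "'a::euclidean_space"
  assumes "z \<in> shrunk_ball x c r k" "\<zeta> \<in> shrunk_ball x c r k"
  shows "norm (\<zeta> - z) < 2 * r / 2 ^ k"
proof -
  have "dist \<zeta> z < r / 2 ^ k + r / 2 ^ k"
    using assms dist_triangle_less_add[of \<zeta> "x + (1 / 2 ^ k) *\<^sub>R (c - x)" "r / 2 ^ k" z "r / 2 ^ k"]
    by (simp add: shrunk_ball_def dist_commute)
  then show ?thesis by (simp add: dist_norm)
qed

text \<open>
  Two distinct points \<open>z\<close> and \<open>\<zeta>\<close> lie in the \<open>k\<close>-th shrunk ball only if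
  \<open>2 ^ k < 4 * r / (norm (x - z) + norm (x - \<zeta>))\<close>; the diagonal is harmless because \<open>Q\<close> vanishes on it.
  For each pair the sum over \<open>k\<close> is therefore a geometric sum with ratio \<open>2 powr \<beta> \<ge> 2\<close>, and its
  last term produces the kernel centred at \<open>x\<close>. The overlap of the shrunk balls does no harm.
\<close>
lemma sum_shrunk_balls_le_kernel:
  fixes x c :: "'a::euclidean_space" and Q :: "'a \<Rightarrow> 'a \<Rightarrow> ennreal"
  assumes Q [measurable]: "case_prod Q \<in> borel_measurable (borel \<Otimes>\<^sub>M borel)"
    and diag: "\<And>z. Q z z = 0" and r: "0 < r" "dist c x \<le> r" and \<beta>: "1 \<le> \<beta>"
  shows "(\<Sum>k. ennreal ((2 ^ k / r) powr \<beta>) *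
           (\<integral>\<^sup>+z\<in>shrunk_ball x c r k. (\<integral>\<^sup>+\<zeta>\<in>shrunk_ball x c r k. Q z \<zeta> \<partial>lborel) \<partial>lborel))
     \<le> (\<integral>\<^sup>+z\<in>ball c r. (\<integral>\<^sup>+\<zeta>\<in>ball c r.
           ennreal (2 * 4 powr \<beta> / (norm (x - z) + norm (x - \<zeta>)) powr \<beta>) * Q z \<zeta> \<partial>lborel) \<partial>lborel)"
proof -
  have [measurable]: "ball c r \<in> sets borel" by simp
  let ?B = "shrunk_ball x c r"
  let ?p = "\<lambda>k::nat. ennreal ((2 ^ k / r) powr \<beta>)"
  let ?F = "\<lambda>k z \<zeta>. ?p k * (Q z \<zeta> * indicator (?B k) \<zeta> * indicator (?B k) z)"
  have F: "?p k * (\<integral>\<^sup>+z\<in>?B k. (\<integral>\<^sup>+\<zeta>\<in>?B k. Q z \<zeta> \<partial>lborel) \<partial>lborel)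
      = (\<integral>\<^sup>+z. (\<integral>\<^sup>+\<zeta>. ?F k z \<zeta> \<partial>lborel) \<partial>lborel)" for k
    by (simp add: nn_integral_cmult nn_integral_multc)
  have "(\<Sum>k. ?p k * (\<integral>\<^sup>+z\<in>?B k. (\<integral>\<^sup>+\<zeta>\<in>?B k. Q z \<zeta> \<partial>lborel) \<partial>lborel))
      = (\<integral>\<^sup>+z. (\<Sum>k. (\<integral>\<^sup>+\<zeta>. ?F k z \<zeta> \<partial>lborel)) \<partial>lborel)"
    unfolding F by (intro nn_integral_suminf[symmetric]) measurable
  also have "\<dots> = (\<integral>\<^sup>+z. (\<integral>\<^sup>+\<zeta>. (\<Sum>k. ?F k z \<zeta>) \<partial>lborel) \<partial>lborel)"
    by (intro nn_integral_cong nn_integral_suminf[symmetric]) measurable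
  also have "\<dots> \<le> (\<integral>\<^sup>+z. (\<integral>\<^sup>+\<zeta>.
      ennreal (2 * 4 powr \<beta> / (norm (x - z) + norm (x - \<zeta>)) powr \<beta>) * Q z \<zeta> *
        indicator (ball c r) \<zeta> * indicator (ball c r) z \<partial>lborel) \<partial>lborel)"
  proof (intro nn_integral_mono)
    fix z \<zeta>
    let ?s = "norm (x - z) + norm (x - \<zeta>)"
    let ?K = "ennreal (2 * 4 powr \<beta> / ?s powr \<beta>)"
    let ?i = "indicator (ball c r) \<zeta> * indicator (ball c r) z :: ennreal"
    show "(\<Sum>k. ?F k z \<zeta>) \<le> ?K * Q z \<zeta> * indicator (ball c r) \<zeta> * indicator (ball c r) z"
    proof (cases "z = \<zeta>")
      case True
      then show ?thesis by (simp add: diag)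
    next
      case False
      then have s: "0 < ?s"
        by (metis add_nonneg_eq_0_iff eq_iff_diff_eq_0 less_eq_real_def norm_eq_zero norm_ge_zero add_nonneg_nonneg)
      let ?d = "\<lambda>k::nat. ennreal (if 2 ^ k < 4 * r / ?s then (2 ^ k) powr \<beta> else 0)"
      have "?F k z \<zeta> \<le> Q z \<zeta> * ?i * ennreal (1 / r powr \<beta>) * ?d k" for k
      proof (cases "z \<in> ?B k \<and> \<zeta> \<in> ?B k")
        case True
        then have "z \<in> ball c r" "\<zeta> \<in> ball c r" "dist x z < 2 * r / 2 ^ k" "dist x \<zeta> < 2 * r / 2 ^ k"
          using shrunk_ball_subset[OF r(2), of k] shrunk_ball_subset_ball_apex[OF r(2), of k] by auto
        then have "?s < 4 * r / 2 ^ k" and i: "?i = 1" by (auto simp: dist_norm)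
        then have "2 ^ k < 4 * r / ?s"
          using s by (simp add: field_simps)
        moreover have "?p k = ennreal (1 / r powr \<beta>) * ennreal ((2 ^ k) powr \<beta>)"
          using r by (simp add: powr_divide ennreal_mult[symmetric])
        ultimately show ?thesis
          using True i by (simp add: mult_ac)
      qed auto
      then have "(\<Sum>k. ?F k z \<zeta>) \<le> (\<Sum>k. Q z \<zeta> * ?i * ennreal (1 / r powr \<beta>) * ?d k)"
        by (intro suminf_le) auto
      also have "\<dots> = Q z \<zeta> * ?i * ennreal (1 / r powr \<beta>) * (\<Sum>k. ?d k)"
        by (rule ennreal_suminf_cmult)
      also have "\<dots> \<le> Q z \<zeta> * ?i * ennreal (1 / r powr \<beta>) * ennreal (2 * (4 * r / ?s) powr \<beta>)"
        using r s \<beta> by (intro mult_left_mono suminf_dyadic_below) auto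
      also have "\<dots> = Q z \<zeta> * ?i * ennreal (1 / r powr \<beta> * (2 * (4 * r / ?s) powr \<beta>))"
        by (subst ennreal_mult) (auto simp: mult.assoc)
      also have "1 / r powr \<beta> * (2 * (4 * r / ?s) powr \<beta>) = 2 * 4 powr \<beta> / ?s powr \<beta>"
        using r s by (simp add: powr_divide powr_mult)
      finally show ?thesis by (simp add: mult_ac)
    qed
  qed
  also have "\<dots> = (\<integral>\<^sup>+z\<in>ball c r. (\<integral>\<^sup>+\<zeta>\<in>ball c r.
           ennreal (2 * 4 powr \<beta> / (norm (x - z) + norm (x - \<zeta>)) powr \<beta>) * Q z \<zeta> \<partial>lborel) \<partial>lborel)"
  proof (rule nn_integral_cong)
    fix z
    show "(\<integral>\<^sup>+\<zeta>. ennreal (2 * 4 powr \<beta> / (norm (x - z) + norm (x - \<zeta>)) powr \<beta>) * Q z \<zeta> *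
          indicator (ball c r) \<zeta> * indicator (ball c r) z \<partial>lborel)
        = (\<integral>\<^sup>+\<zeta>\<in>ball c r.
            ennreal (2 * 4 powr \<beta> / (norm (x - z) + norm (x - \<zeta>)) powr \<beta>) * Q z \<zeta> \<partial>lborel) * indicator (ball c r) z"
      by (rule nn_integral_multc) simp
  qed
  finally show ?thesis .
qed

text \<open>
  The \<open>k\<close>-th shrunk ball is contained in \<open>ball x (2 * r / 2 ^ k) \<inter> ball c r\<close> and occupies at least the
  fraction \<open>1 / 2 ^ n\<close> of it, so averages over shrunk balls converge whenever those over the sets in
  the definition of a Lebesgue point do.
\<close>
lemma average_shrunk_ball_tendsto:
  fixes g :: "'a::euclidean_space \<Rightarrow> real"
  assumes g: "g \<in> borel_measurable borel" "set_integrable lborel (ball c r) g"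
    and r: "0 < r" "dist c x \<le> r"
    and lim: "((\<lambda>\<rho>. (LINT y:(ball x \<rho> \<inter> ball c r)|lborel. \<bar>g y - a\<bar>) / measure lborel (ball x \<rho> \<inter> ball c r))
        \<longlongrightarrow> 0) (at_right 0)"
  shows "(\<lambda>k. average (shrunk_ball x c r k) g) \<longlonglongrightarrow> a"
proof -
  let ?B = "shrunk_ball x c r"
  define \<rho> where "\<rho> k = 2 * r / 2 ^ k" for k :: nat
  define L where "L E = (LINT y:E|lborel. \<bar>g y - a\<bar>)" for E
  define P where "P k = L (ball x (\<rho> k) \<inter> ball c r) / measure lborel (ball x (\<rho> k) \<inter> ball c r)" for k
  have "(\<lambda>k. 2 * r * (1 / 2) ^ k) \<longlonglongrightarrow> 2 * r * 0"
    by (intro tendsto_intros LIMSEQ_power_zero) simp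
  then have "\<rho> \<longlonglongrightarrow> 0"
    by (simp add: \<rho>_def [abs_def] power_divide)
  then have "filterlim \<rho> (at_right 0) sequentially"
    using r by (simp add: filterlim_at \<rho>_def)
  from filterlim_compose[OF lim this] have P: "P \<longlonglongrightarrow> 0"
    by (simp add: P_def [abs_def] L_def)
  have int: "set_integrable lborel E (\<lambda>y. \<bar>g y - a\<bar>)" if "E \<in> sets borel" "E \<subseteq> ball c r" for E
  proof -
    have "emeasure lborel E \<le> emeasure lborel (ball c r)"
      using that by (intro emeasure_mono) auto
    then have "set_integrable lborel E (\<lambda>y. a)"
      using that emeasure_lborel_ball_finite[of c r] by (simp add: set_integrable_def le_less_trans)
    moreover have "set_integrable lborel E g"
      using g(2) that by (rule_tac set_integrable_subset) auto
    ultimately show ?thesis by (intro set_integrable_abs set_integral_diff)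
  qed
  have nn_L: "(\<integral>\<^sup>+y\<in>E. ennreal \<bar>a - g y\<bar> \<partial>lborel) = ennreal (L E)"
    if "E \<in> sets borel" "E \<subseteq> ball c r" for E
  proof -
    have "(\<integral>\<^sup>+y\<in>E. ennreal \<bar>a - g y\<bar> \<partial>lborel) = (\<integral>\<^sup>+y. ennreal (indicator E y * \<bar>g y - a\<bar>) \<partial>lborel)"
      by (intro nn_integral_cong) (auto simp: indicator_def abs_minus_commute)
    also have "\<dots> = ennreal (L E)"
      using int[OF that] unfolding L_def set_lebesgue_integral_def set_integrable_def
      by (subst nn_integral_eq_integral) auto
    finally show ?thesis .
  qed
  have bound: "\<bar>average (?B k) g - a\<bar> \<le> 2 ^ DIM('a) * P k" for k
  proof -
    let ?E = "ball x (\<rho> k) \<inter> ball c r"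
    have sub: "?B k \<subseteq> ?E" "?E \<subseteq> ball c r" "?B k \<subseteq> ball c r"
      using shrunk_ball_subset[OF r(2), of k] shrunk_ball_subset_ball_apex[OF r(2), of k]
      by (auto simp: \<rho>_def)
    have B_pos: "0 < measure lborel (?B k)"
      using r by (simp add: measure_shrunk_ball)
    have ball_fin: "ball x (\<rho> k) \<in> fmeasurable lborel"
      by (intro fmeasurableI emeasure_lborel_ball_finite) auto
    then have E_fin: "?E \<in> fmeasurable lborel"
      by (intro fmeasurable_Int_fmeasurable) auto
    have E_pos: "0 < measure lborel ?E"
      using B_pos measure_mono_fmeasurable[OF sub(1) _ E_fin] by simp
    have "measure lborel ?E \<le> measure lborel (ball x (\<rho> k))"
      by (intro measure_mono_fmeasurable ball_fin) auto
    also have "\<dots> = 2 ^ DIM('a) * measure lborel (?B k)"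
      using r by (simp add: \<rho>_def measure_shrunk_ball content_ball power_mult_distrib power_divide)
    finally have "measure lborel ?E / measure lborel (?B k) \<le> 2 ^ DIM('a)"
      using B_pos by (simp add: field_simps)
    moreover have L_E: "0 \<le> L ?E"
      unfolding L_def set_lebesgue_integral_def by (intro integral_nonneg_AE) (auto simp: indicator_def)
    ultimately have "measure lborel ?E / measure lborel (?B k) * P k \<le> 2 ^ DIM('a) * P k"
      by (intro mult_right_mono) (simp_all add: P_def)
    then have le: "1 / measure lborel (?B k) * L ?E \<le> 2 ^ DIM('a) * P k"
      using E_pos by (simp add: P_def)
    have "ennreal \<bar>a - average (?B k) g\<bar>
        \<le> ennreal (1 / measure lborel (?B k)) * (\<integral>\<^sup>+y\<in>?B k. ennreal \<bar>a - g y\<bar> \<partial>lborel)"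
      using g(2) sub(3) B_pos
      by (intro average_deviation) (auto intro: set_integrable_subset)
    also have "(\<integral>\<^sup>+y\<in>?B k. ennreal \<bar>a - g y\<bar> \<partial>lborel) \<le> (\<integral>\<^sup>+y\<in>?E. ennreal \<bar>a - g y\<bar> \<partial>lborel)"
      using sub(1) by (intro nn_integral_mono) (auto simp: indicator_def)
    also have "\<dots> = ennreal (L ?E)"
      using sub by (intro nn_L) auto
    also have "ennreal (1 / measure lborel (?B k)) * ennreal (L ?E) = ennreal (1 / measure lborel (?B k) * L ?E)"
      using L_E by (intro ennreal_mult[symmetric]) auto
    finally have "ennreal \<bar>a - average (?B k) g\<bar> \<le> ennreal (1 / measure lborel (?B k) * L ?E)"
      by (simp add: mult_left_mono)
    then have "\<bar>a - average (?B k) g\<bar> \<le> 1 / measure lborel (?B k) * L ?E"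
      using L_E by (subst (asm) ennreal_le_iff) auto
    then show ?thesis using le by (simp add: abs_minus_commute)
  qed
  have "(\<lambda>k. average (?B k) g - a) \<longlonglongrightarrow> 0"
  proof (rule Lim_null_comparison)
    show "(\<lambda>k. 2 ^ DIM('a) * P k) \<longlonglongrightarrow> 0"
      using tendsto_mult_left[OF P] by simp
  qed (use bound in auto)
  then show ?thesis by (rule LIM_zero_cancel)
qed

lemma set_nn_integral_cmult_iterated:
  fixes N :: "'a::euclidean_space \<Rightarrow> 'a \<Rightarrow> ennreal"
  assumes [measurable]: "case_prod N \<in> borel_measurable (borel \<Otimes>\<^sub>M borel)" "S \<in> sets borel"
  shows "(\<integral>\<^sup>+z\<in>S. (\<integral>\<^sup>+\<zeta>\<in>S. e * N z \<zeta> \<partial>lborel) \<partial>lborel) = e * (\<integral>\<^sup>+z\<in>S. (\<integral>\<^sup>+\<zeta>\<in>S. N z \<zeta> \<partial>lborel) \<partial>lborel)"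
proof -
  have "(\<integral>\<^sup>+\<zeta>\<in>S. e * N z \<zeta> \<partial>lborel) = e * (\<integral>\<^sup>+\<zeta>\<in>S. N z \<zeta> \<partial>lborel)" for z
    unfolding mult.assoc by (intro nn_integral_cmult) measurable
  then show ?thesis
    by (simp only: mult.assoc) (intro nn_integral_cmult, measurable)
qed

section \<open>The telescoping estimate\<close>
text \<open>
  Here \<open>q\<close> stands for the weighted mean; all that matters about it is the estimate by the average
  distance of \<open>g\<close> from a constant. Let \<open>n\<close> be the dimension. Telescoping the averages over the shrunk balls and estimating
  \<open>average (ball c r) g - q\<close> by the term \<open>k = 0\<close> bounds \<open>a - q\<close> by a series of oscillations over the
  shrunk balls with weights proportional to \<open>(2 ^ k / r) ^ (2 * n)\<close>. The fractional Poincare inequality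
  consumes \<open>(r / 2 ^ k) powr (n + \<alpha>)\<close> of each weight. What remains is \<open>(2 ^ k / r) powr (n - \<alpha>)\<close>, with
  an exponent \<open>n - \<alpha> \<ge> 1\<close> because \<open>n \<ge> 2\<close>, as needed for \<open>sum_shrunk_balls_le_kernel\<close>.
\<close>
lemma deviation_le_double_kernel:
  fixes g :: "'a::euclidean_space \<Rightarrow> real"
  assumes dim: "2 \<le> DIM('a)" and \<alpha>: "0 < \<alpha>" "\<alpha> < 1"
    and r: "0 < r" "dist c x \<le> r"
    and g [measurable]: "g \<in> borel_measurable borel" and int: "set_integrable lborel (ball c r) g"
    and lim: "(\<lambda>k. average (shrunk_ball x c r k) g) \<longlonglongrightarrow> a"
    and "0 \<le> m"
    and q: "\<And>u. ennreal \<bar>u - q\<bar> \<le> ennreal (m / r ^ DIM('a)) * (\<integral>\<^sup>+y\<in>ball c r. ennreal \<bar>u - g y\<bar> \<partial>lborel)"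
  defines "\<omega> \<equiv> unit_ball_vol (real DIM('a))"
  shows "ennreal \<bar>a - q\<bar> \<le> ennreal (8 * 8 ^ DIM('a) * (2 ^ DIM('a) / \<omega>\<^sup>2 + m / \<omega>) * (1 - \<alpha>)) *
    (\<integral>\<^sup>+z\<in>ball c r. (\<integral>\<^sup>+\<zeta>\<in>ball c r. ennreal (\<bar>g \<zeta> - g z\<bar> /
        (norm (\<zeta> - z) powr (real DIM('a) + \<alpha>) *
         (norm (x - z) + norm (x - \<zeta>)) powr (real DIM('a) - \<alpha>))) \<partial>lborel) \<partial>lborel)"
    (is "_ \<le> _ * ?double")
proof -
  let ?n = "DIM('a)" and ?B = "shrunk_ball x c r" and ?A = "\<lambda>k. average (shrunk_ball x c r k) g"
  let ?t = "\<lambda>k::nat. 2 ^ k / r"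
  define \<beta> where "\<beta> = real ?n - \<alpha>"
  define Q where "Q z \<zeta> = ennreal (\<bar>g \<zeta> - g z\<bar> / norm (\<zeta> - z) powr (real ?n + \<alpha>))" for z \<zeta>
  define I where "I k = (\<integral>\<^sup>+z\<in>?B k. (\<integral>\<^sup>+\<zeta>\<in>?B k. ennreal \<bar>g \<zeta> - g z\<bar> \<partial>lborel) \<partial>lborel)" for k
  define R where "R k = (\<integral>\<^sup>+z\<in>?B k. (\<integral>\<^sup>+\<zeta>\<in>?B k. Q z \<zeta> \<partial>lborel) \<partial>lborel)" for k
  define K where "K = 2 ^ ?n / \<omega>\<^sup>2 + m / \<omega>"
  have \<omega>: "0 < \<omega>" by (simp add: \<omega>_def)
  have K: "0 \<le> K" using \<omega> \<open>0 \<le> m\<close> by (simp add: K_def)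
  have \<beta>: "1 \<le> \<beta>" using dim \<alpha> by (simp add: \<beta>_def)
  have powers: "s ^ (2 * ?n) * (2 / s) powr (real ?n + \<alpha>) = 2 powr (real ?n + \<alpha>) * s powr \<beta>"
    if s: "0 < s" for s
  proof -
    define P where "P = s powr (real ?n + \<alpha>)"
    have "s ^ (2 * ?n) = s powr real (2 * ?n)"
      by (rule powr_realpow[OF s, symmetric])
    also have "real (2 * ?n) = (real ?n + \<alpha>) + \<beta>"
      by (simp add: \<beta>_def)
    also have "s powr ((real ?n + \<alpha>) + \<beta>) = P * s powr \<beta>"
      unfolding P_def by (rule powr_add)
    finally have "s ^ (2 * ?n) = P * s powr \<beta>" .
    moreover have "(2 / s) powr (real ?n + \<alpha>) = 2 powr (real ?n + \<alpha>) / P"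
      unfolding P_def by (rule powr_divide)
    moreover have "P \<noteq> 0" using s by (simp add: P_def)
    ultimately show ?thesis by simp
  qed
  have vol: "measure lborel (?B k) = \<omega> * (r / 2 ^ k) ^ ?n" for k
    unfolding \<omega>_def by (rule measure_shrunk_ball[OF r(1)])
  have pos: "0 < measure lborel (?B k)" for k
    unfolding vol using \<omega> r by simp
  have intB: "set_integrable lborel (?B k) g" for k
    using int shrunk_ball_subset[OF r(2), of k] by (rule_tac set_integrable_subset) auto

  \<comment> \<open>The factor \<open>2 ^ n\<close> is the ratio of the volumes of consecutive shrunk balls.\<close>
  have step: "ennreal \<bar>?A k - ?A (Suc k)\<bar> \<le> ennreal (2 ^ ?n / \<omega>\<^sup>2 * ?t k ^ (2 * ?n)) * I k" for k
  proof -
    define X where "X = (r / 2 ^ k) ^ ?n"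
    have "(r / 2 ^ Suc k) ^ ?n = X / 2 ^ ?n"
      by (simp add: X_def power_divide power_mult_distrib)
    moreover have "?t k ^ (2 * ?n) = 1 / (X * X)"
      by (simp only: mult_2 power_add) (simp add: X_def power_divide)
    ultimately have vols: "1 / measure lborel (?B (Suc k)) / measure lborel (?B k) = 2 ^ ?n / \<omega>\<^sup>2 * ?t k ^ (2 * ?n)"
      unfolding vol by (simp add: X_def[symmetric] power2_eq_square)
    have "ennreal \<bar>?A k - ?A (Suc k)\<bar>
        \<le> ennreal (1 / measure lborel (?B (Suc k))) * (\<integral>\<^sup>+z\<in>?B (Suc k). ennreal \<bar>?A k - g z\<bar> \<partial>lborel)"
      by (rule average_deviation[OF _ pos intB]) simp
    then have "ennreal \<bar>?A k - ?A (Suc k)\<bar>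
        \<le> ennreal (1 / measure lborel (?B (Suc k)) / measure lborel (?B k)) * I k"
      unfolding I_def
      by (rule average_diff_le[OF g _ pos intB, rotated 2]) (auto intro: shrunk_ball_Suc_subset[OF r(2), THEN subsetD])
    then show ?thesis by (simp only: vols)
  qed
  have tail: "ennreal \<bar>a - ?A 0\<bar> \<le> (\<Sum>k. ennreal (2 ^ ?n / \<omega>\<^sup>2 * ?t k ^ (2 * ?n)) * I k)"
    using lim step by (rule limit_deviation_le_suminf)

  have vol_0: "m / r ^ ?n / measure lborel (?B 0) = m / \<omega> * ?t 0 ^ (2 * ?n)"
    by (simp only: vol mult_2 power_add) (simp add: power_divide)
  have "ennreal \<bar>?A 0 - q\<bar> \<le> ennreal (m / r ^ ?n / measure lborel (?B 0)) * I 0"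
    unfolding I_def
    by (rule average_diff_le[OF g _ pos intB _ q]) (use r \<open>0 \<le> m\<close> in auto)
  then have "ennreal \<bar>?A 0 - q\<bar> \<le> ennreal (m / \<omega> * ?t 0 ^ (2 * ?n)) * I 0"
    by (simp only: vol_0)
  also have "\<dots> \<le> (\<Sum>k. ennreal (m / \<omega> * ?t k ^ (2 * ?n)) * I k)"
    using sum_le_suminf[of "\<lambda>k. ennreal (m / \<omega> * ?t k ^ (2 * ?n)) * I k" "{0}"] by simp
  finally have head: "ennreal \<bar>?A 0 - q\<bar> \<le> (\<Sum>k. ennreal (m / \<omega> * ?t k ^ (2 * ?n)) * I k)" .

  have "(\<Sum>k. ennreal (?t k powr \<beta>) * R k) \<le> (\<integral>\<^sup>+z\<in>ball c r. (\<integral>\<^sup>+\<zeta>\<in>ball c r.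
      ennreal (2 * 4 powr \<beta> / (norm (x - z) + norm (x - \<zeta>)) powr \<beta>) * Q z \<zeta> \<partial>lborel) \<partial>lborel)"
    unfolding R_def using r \<beta>
    by (intro sum_shrunk_balls_le_kernel) (auto simp: Q_def)
  also have "\<dots> = (\<integral>\<^sup>+z\<in>ball c r. (\<integral>\<^sup>+\<zeta>\<in>ball c r. ennreal (2 * 4 powr \<beta>) * ennreal (\<bar>g \<zeta> - g z\<bar> /
      (norm (\<zeta> - z) powr (real ?n + \<alpha>) * (norm (x - z) + norm (x - \<zeta>)) powr \<beta>)) \<partial>lborel) \<partial>lborel)"
    by (simp add: Q_def ennreal_mult[symmetric] mult_ac)
  also have "\<dots> = ennreal (2 * 4 powr \<beta>) * ?double"
    unfolding \<beta>_def by (rule set_nn_integral_cmult_iterated) measurable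
  finally have kernel: "(\<Sum>k. ennreal (?t k powr \<beta>) * R k) \<le> ennreal (2 * 4 powr \<beta>) * ?double" .

  have "ennreal \<bar>a - q\<bar> \<le> ennreal (\<bar>a - ?A 0\<bar> + \<bar>?A 0 - q\<bar>)"
    by (intro ennreal_leI) simp
  also have "\<dots> = ennreal \<bar>a - ?A 0\<bar> + ennreal \<bar>?A 0 - q\<bar>"
    by (intro ennreal_plus) auto
  also have "\<dots> \<le> (\<Sum>k. ennreal (2 ^ ?n / \<omega>\<^sup>2 * ?t k ^ (2 * ?n)) * I k)
      + (\<Sum>k. ennreal (m / \<omega> * ?t k ^ (2 * ?n)) * I k)"
    by (intro add_mono tail head)
  also have "\<dots> = (\<Sum>k. ennreal (2 ^ ?n / \<omega>\<^sup>2 * ?t k ^ (2 * ?n)) * I k + ennreal (m / \<omega> * ?t k ^ (2 * ?n)) * I k)"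
    by (intro suminf_add) auto
  also have "\<dots> = (\<Sum>k. ennreal (K * ?t k ^ (2 * ?n)) * I k)"
  proof (intro suminf_cong)
    fix k
    have "ennreal (K * ?t k ^ (2 * ?n)) = ennreal (2 ^ ?n / \<omega>\<^sup>2 * ?t k ^ (2 * ?n) + m / \<omega> * ?t k ^ (2 * ?n))"
      by (simp only: K_def distrib_right)
    also have "\<dots> = ennreal (2 ^ ?n / \<omega>\<^sup>2 * ?t k ^ (2 * ?n)) + ennreal (m / \<omega> * ?t k ^ (2 * ?n))"
      using r \<omega> \<open>0 \<le> m\<close> by (intro ennreal_plus) auto
    finally show "ennreal (2 ^ ?n / \<omega>\<^sup>2 * ?t k ^ (2 * ?n)) * I k + ennreal (m / \<omega> * ?t k ^ (2 * ?n)) * I k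
        = ennreal (K * ?t k ^ (2 * ?n)) * I k"
      by (simp only: distrib_right)
  qed
  also have "\<dots> \<le> (\<Sum>k. ennreal (K * (1 - \<alpha>) * (2 * 2 powr (real ?n + \<alpha>))) * (ennreal (?t k powr \<beta>) * R k))"
  proof (rule suminf_le)
    fix k
    let ?L = "2 * r / 2 ^ k"
    have "I k \<le> ennreal ((1 - \<alpha>) * (2 * ?L powr (real ?n + \<alpha>))) * R k"
      unfolding I_def R_def Q_def
      by (rule fractional_poincare_convex[OF convex_shrunk_ball _ g shrunk_ball_diameter _ \<alpha>])
        (use r in simp_all)
    then have "ennreal (K * ?t k ^ (2 * ?n)) * I k
        \<le> ennreal (K * ?t k ^ (2 * ?n)) * (ennreal ((1 - \<alpha>) * (2 * ?L powr (real ?n + \<alpha>))) * R k)"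
      by (rule mult_left_mono) simp
    also have "\<dots> = ennreal (K * ?t k ^ (2 * ?n) * ((1 - \<alpha>) * (2 * ?L powr (real ?n + \<alpha>)))) * R k"
      using K r \<alpha> by (subst ennreal_mult) (auto simp: mult.assoc)
    also have "K * ?t k ^ (2 * ?n) * ((1 - \<alpha>) * (2 * ?L powr (real ?n + \<alpha>)))
        = K * (1 - \<alpha>) * (2 * 2 powr (real ?n + \<alpha>)) * ?t k powr \<beta>"
    proof -
      have "?L = 2 / ?t k" "0 < ?t k" using r by simp_all
      then have "?t k ^ (2 * ?n) * ?L powr (real ?n + \<alpha>) = 2 powr (real ?n + \<alpha>) * ?t k powr \<beta>"
        by (simp only: powers)
      then have "K * (1 - \<alpha>) * 2 * (?t k ^ (2 * ?n) * ?L powr (real ?n + \<alpha>))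
          = K * (1 - \<alpha>) * 2 * (2 powr (real ?n + \<alpha>) * ?t k powr \<beta>)"
        by (rule arg_cong)
      then show ?thesis by (simp only: mult_ac)
    qed
    also have "ennreal (K * (1 - \<alpha>) * (2 * 2 powr (real ?n + \<alpha>)) * ?t k powr \<beta>) * R k
        = ennreal (K * (1 - \<alpha>) * (2 * 2 powr (real ?n + \<alpha>))) * (ennreal (?t k powr \<beta>) * R k)"
      using K \<alpha> by (subst ennreal_mult) (auto simp: mult.assoc)
    finally show "ennreal (K * ?t k ^ (2 * ?n)) * I k
        \<le> ennreal (K * (1 - \<alpha>) * (2 * 2 powr (real ?n + \<alpha>))) * (ennreal (?t k powr \<beta>) * R k)" .
  qed auto
  also have "\<dots> = ennreal (K * (1 - \<alpha>) * (2 * 2 powr (real ?n + \<alpha>))) * (\<Sum>k. ennreal (?t k powr \<beta>) * R k)"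
    by (rule ennreal_suminf_cmult)
  also have "\<dots> \<le> ennreal (K * (1 - \<alpha>) * (2 * 2 powr (real ?n + \<alpha>))) * (ennreal (2 * 4 powr \<beta>) * ?double)"
    by (intro mult_left_mono kernel) simp
  also have "ennreal (K * (1 - \<alpha>) * (2 * 2 powr (real ?n + \<alpha>))) * (ennreal (2 * 4 powr \<beta>) * ?double)
      = ennreal (K * (1 - \<alpha>) * (2 * 2 powr (real ?n + \<alpha>)) * (2 * 4 powr \<beta>)) * ?double"
    using K \<alpha> by (subst ennreal_mult) (auto simp: mult.assoc)
  also have "\<dots> \<le> ennreal (8 * 8 ^ ?n * K * (1 - \<alpha>)) * ?double"
  proof (intro mult_right_mono ennreal_leI)
    \<comment> \<open>The exponents \<open>n + \<alpha> \<le> n + 1\<close> and \<open>n - \<alpha> \<le> n\<close> make the constant independent of \<open>\<alpha>\<close>.\<close>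
    define p q where "p = (2::real) powr (real ?n + \<alpha>)" and "q = (4::real) powr \<beta>"
    have "p \<le> 2 powr (real ?n + 1)" "q \<le> 4 powr real ?n"
      using \<alpha> by (auto intro!: powr_mono simp: \<beta>_def p_def q_def)
    then have "p * q \<le> 2 powr (real ?n + 1) * 4 powr real ?n"
      by (intro mult_mono) (auto simp: q_def)
    also have "\<dots> = 2 * (2 ^ ?n * 4 ^ ?n)"
      by (simp add: powr_add powr_realpow)
    also have "2 ^ ?n * 4 ^ ?n = (8::real) ^ ?n"
      by (simp add: power_mult_distrib[symmetric])
    finally have "K * (1 - \<alpha>) * (4 * (p * q)) \<le> K * (1 - \<alpha>) * (8 * 8 ^ ?n)"
      using K \<alpha> by (intro mult_left_mono) auto
    then have "K * (1 - \<alpha>) * (2 * p) * (2 * q) \<le> 8 * 8 ^ ?n * K * (1 - \<alpha>)"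
      by (simp add: mult_ac)
    then show "K * (1 - \<alpha>) * (2 * 2 powr (real ?n + \<alpha>)) * (2 * 4 powr \<beta>) \<le> 8 * 8 ^ ?n * K * (1 - \<alpha>)"
      by (simp only: p_def q_def)
  qed simp
  finally show ?thesis
    unfolding K_def .
qed

section \<open>Lebesgue measurable functions and the final estimate\<close>
text \<open>
  Fubini's theorem on \<open>lborel\<close> needs a Borel function. Neither the double integrals nor the averages
  around a point see the change on a null set.
\<close>
lemma ex_borel_representative:
  fixes v :: "'a::euclidean_space \<Rightarrow> real"
  assumes v: "set_integrable lebesgue S v" and S: "S \<in> sets borel"
  obtains g where "g \<in> borel_measurable borel" "set_integrable lborel S g"
    and "AE y in lborel. y \<in> S \<longrightarrow> v y = g y"
    and "\<And>E a. E \<in> sets borel \<Longrightarrow> E \<subseteq> S \<Longrightarrow>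
      (LINT y:E|lebesgue. \<bar>v y - a\<bar>) = (LINT y:E|lborel. \<bar>g y - a\<bar>)"
proof -
  define F where "F y = indicator S y * v y" for y
  have F: "integrable lebesgue F"
    using v by (simp add: set_integrable_def F_def [abs_def])
  then have F_meas [measurable]: "F \<in> borel_measurable lebesgue" by simp
  then obtain g where g: "g \<in> borel_measurable lborel" and eq: "AE y in lborel. F y = g y"
    using completion_ex_borel_measurable_real by blast
  have [measurable]: "g \<in> borel_measurable borel" "g \<in> borel_measurable lebesgue"
    using g by (auto intro: measurable_completion)
  have eq': "AE y in lebesgue. F y = g y"
    using eq by (rule AE_completion)
  have "integrable lebesgue g"
    using F eq' by (subst integrable_cong_AE[where g = F]) (auto simp: eq_commute)
  then have "integrable lborel g"
    by (simp add: integrable_completion)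
  then have int: "set_integrable lborel S g"
    unfolding set_integrable_def using S by (intro integrable_mult_indicator) auto
  have AE: "AE y in lborel. y \<in> S \<longrightarrow> v y = g y"
    using eq by eventually_elim (auto simp: F_def indicator_def)
  have means: "(LINT y:E|lebesgue. \<bar>v y - a\<bar>) = (LINT y:E|lborel. \<bar>g y - a\<bar>)"
    if [measurable]: "E \<in> sets borel" and "E \<subseteq> S" for E a
  proof -
    have [measurable]: "E \<in> sets lebesgue" using that by simp
    have "(LINT y:E|lebesgue. \<bar>v y - a\<bar>) = (\<integral>y. indicator E y * \<bar>F y - a\<bar> \<partial>lebesgue)"
      unfolding set_lebesgue_integral_def using \<open>E \<subseteq> S\<close>
      by (intro Bochner_Integration.integral_cong) (auto simp: F_def indicator_def)
    also have "\<dots> = (\<integral>y. indicator E y * \<bar>g y - a\<bar> \<partial>lebesgue)"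
      by (intro integral_cong_AE) (use eq' in auto)
    also have "\<dots> = (LINT y:E|lborel. \<bar>g y - a\<bar>)"
      unfolding set_lebesgue_integral_def by (subst integral_completion) auto
    finally show ?thesis .
  qed
  show ?thesis by (rule that[OF _ int AE means]) simp_all
qed

lemma nn_integral_lebesgue_eq_lborel_representative:
  fixes v g :: "'a::euclidean_space \<Rightarrow> real"
  assumes eq: "AE y in lborel. y \<in> S \<longrightarrow> v y = g y"
  shows "(\<integral>\<^sup>+y\<in>S. H y (v y) \<partial>lebesgue) = (\<integral>\<^sup>+y\<in>S. H y (g y) \<partial>lborel)"
  unfolding nn_integral_completion
proof (rule nn_integral_cong_AE)
  show "AE y in lborel. H y (v y) * indicator S y = H y (g y) * indicator S y"
    using eq by eventually_elim (auto simp: indicator_def)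
qed

text \<open>
  Dropping \<open>norm (x - \<zeta>)\<close> from the denominator increases the kernel on the left; at the single
  point \<open>z = x\<close>, where division by zero would break the comparison, nothing is integrated.
\<close>
lemma riesz_kernel_dominates:
  fixes g :: "'a::euclidean_space \<Rightarrow> real"
  assumes [measurable]: "g \<in> borel_measurable borel" "S \<in> sets borel" and "0 \<le> \<beta>"
  shows "(\<integral>\<^sup>+z\<in>S. (\<integral>\<^sup>+\<zeta>\<in>S. ennreal (\<bar>g \<zeta> - g z\<bar> /
            (norm (\<zeta> - z) powr s * (norm (x - z) + norm (x - \<zeta>)) powr \<beta>)) \<partial>lborel) \<partial>lborel)
      \<le> (\<integral>\<^sup>+z\<in>S. (\<integral>\<^sup>+\<zeta>\<in>S. ennreal (\<bar>g \<zeta> - g z\<bar> / norm (\<zeta> - z) powr s) \<partial>lborel) *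
            ennreal (1 / norm (x - z) powr \<beta>) \<partial>lborel)"
proof (rule nn_integral_mono_AE)
  let ?Q = "\<lambda>z \<zeta>. ennreal (\<bar>g \<zeta> - g z\<bar> / norm (\<zeta> - z) powr s)"
  let ?D = "\<lambda>z \<zeta>. ennreal (\<bar>g \<zeta> - g z\<bar> / (norm (\<zeta> - z) powr s * (norm (x - z) + norm (x - \<zeta>)) powr \<beta>))"
  have "(\<integral>\<^sup>+\<zeta>\<in>S. ?D z \<zeta> \<partial>lborel) \<le> (\<integral>\<^sup>+\<zeta>\<in>S. ?Q z \<zeta> \<partial>lborel) * ennreal (1 / norm (x - z) powr \<beta>)"
    if "z \<noteq> x" for z
  proof -
    have "?D z \<zeta> \<le> ?Q z \<zeta> * ennreal (1 / norm (x - z) powr \<beta>)" for \<zeta>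
    proof -
      have "norm (x - z) powr \<beta> \<le> (norm (x - z) + norm (x - \<zeta>)) powr \<beta>"
        using \<open>0 \<le> \<beta>\<close> by (intro powr_mono2) auto
      then have "1 / (norm (x - z) + norm (x - \<zeta>)) powr \<beta> \<le> 1 / norm (x - z) powr \<beta>"
        using that by (intro frac_le) auto
      then have "\<bar>g \<zeta> - g z\<bar> / norm (\<zeta> - z) powr s * (1 / (norm (x - z) + norm (x - \<zeta>)) powr \<beta>)
          \<le> \<bar>g \<zeta> - g z\<bar> / norm (\<zeta> - z) powr s * (1 / norm (x - z) powr \<beta>)"
        by (intro mult_left_mono) auto
      then show ?thesis
        by (simp add: ennreal_mult[symmetric] ennreal_leI)
    qed
    then have "(\<integral>\<^sup>+\<zeta>\<in>S. ?D z \<zeta> \<partial>lborel)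
        \<le> (\<integral>\<^sup>+\<zeta>. ?Q z \<zeta> * indicator S \<zeta> * ennreal (1 / norm (x - z) powr \<beta>) \<partial>lborel)"
      by (intro nn_integral_mono) (auto simp: indicator_def)
    also have "\<dots> = (\<integral>\<^sup>+\<zeta>\<in>S. ?Q z \<zeta> \<partial>lborel) * ennreal (1 / norm (x - z) powr \<beta>)"
      by (rule nn_integral_multc) simp
    finally show ?thesis .
  qed
  then show "AE z in lborel. (\<integral>\<^sup>+\<zeta>\<in>S. ?D z \<zeta> \<partial>lborel) * indicator S z
      \<le> (\<integral>\<^sup>+\<zeta>\<in>S. ?Q z \<zeta> \<partial>lborel) * ennreal (1 / norm (x - z) powr \<beta>) * indicator S z"
    using AE_lborel_singleton[of x] by (auto elim!: eventually_mono intro!: mult_right_mono)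
qed

lemma weighted_mean_deviation:
  fixes v \<psi> :: "real^'n \<Rightarrow> real"
  assumes S: "S \<in> sets lebesgue" and v: "set_integrable lebesgue S v"
    and \<psi>: "in_Linf S \<psi>" "AE y in lebesgue_on S. 0 \<le> \<psi> y" "L1_norm S \<psi> = 1" "Linf_norm S \<psi> \<le> ereal m"
    and m: "m \<le> m'" "0 \<le> m'"
  shows "ennreal \<bar>u - weighted_mean S \<psi> v\<bar> \<le> ennreal m' * (\<integral>\<^sup>+y\<in>S. ennreal \<bar>u - v y\<bar> \<partial>lebesgue)"
  unfolding weighted_mean_def
proof (rule weighted_average_deviation[OF S v])
  show "(\<lambda>y. indicator S y * \<psi> y) \<in> borel_measurable lebesgue"
    using \<psi>(1) S by (simp add: in_Linf_def borel_measurable_restrict_space_iff)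
  have nonneg: "AE y in lebesgue. y \<in> S \<longrightarrow> 0 \<le> \<psi> y"
    using \<psi>(2) S by (subst (asm) AE_restrict_space_iff) auto
  have "AE y in lebesgue_on S. ereal \<bar>\<psi> y\<bar> \<le> Linf_norm S \<psi>"
    unfolding Linf_norm_def by (rule esssup_AE)
  then have "AE y in lebesgue_on S. \<psi> y \<le> m'"
  proof eventually_elim
    case (elim y)
    then have "ereal \<bar>\<psi> y\<bar> \<le> ereal m" using \<psi>(4) by (rule order_trans)
    then show ?case using m by simp
  qed
  then have upper: "AE y in lebesgue. y \<in> S \<longrightarrow> \<psi> y \<le> m'"
    using S by (subst (asm) AE_restrict_space_iff) auto
  show "AE y in lebesgue. y \<in> S \<longrightarrow> 0 \<le> \<psi> y \<and> \<psi> y \<le> m'"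
    using nonneg upper by eventually_elim auto
  have "(\<integral>\<^sup>+y\<in>S. ennreal (\<psi> y) \<partial>lebesgue) = L1_norm S \<psi>"
    unfolding L1_norm_def
  proof (rule nn_integral_cong_AE)
    show "AE y in lebesgue. ennreal (\<psi> y) * indicator S y = ennreal \<bar>\<psi> y\<bar> * indicator S y"
      using nonneg by eventually_elim (auto simp: indicator_def)
  qed
  then show "(\<integral>\<^sup>+y\<in>S. ennreal (\<psi> y) \<partial>lebesgue) = 1" using \<psi>(3) by simp
qed (rule m)

theorem lemmaA1:
  fixes c0 :: real
  assumes "CARD('n::finite) \<ge> 2"
  shows "\<exists>C>0. \<forall>(\<alpha>::real) (c::real^'n) (r::real) (\<psi>::real^'n \<Rightarrow> real).
           0 < \<alpha> \<and> \<alpha> < 1 \<and> 0 < r \<and>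
           in_Linf (ball c r) \<psi> \<and>
           (AE y in lebesgue_on (ball c r). 0 \<le> \<psi> y) \<and>
           L1_norm (ball c r) \<psi> = 1 \<and>
           Linf_norm (ball c r) \<psi> \<le> ereal (c0 / r ^ CARD('n)) \<longrightarrow>
           (\<forall>v x a.
              set_integrable lebesgue (ball c r) v \<and>
              x \<in> closure (ball c r) \<and>
              lebesgue_point (ball c r) v x a \<longrightarrow>
              ennreal \<bar>a - weighted_mean (ball c r) \<psi> v\<bar>
                \<le> ennreal (C * (1 - \<alpha>)) * double_kernel_integral (ball c r) \<alpha> v x \<and>
              ennreal (C * (1 - \<alpha>)) * double_kernel_integral (ball c r) \<alpha> v x
                \<le> ennreal (C * (1 - \<alpha>)) * riesz_kernel_integral (ball c r) \<alpha> v x)"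
proof -
  define \<omega> where "\<omega> = unit_ball_vol (real CARD('n))"
  \<comment> \<open>The constant of \<open>deviation_le_double_kernel\<close>; \<open>\<bar>c0\<bar>\<close> makes it positive for every \<open>c0\<close>.\<close>
  define C where "C = 8 * 8 ^ CARD('n) * (2 ^ CARD('n) / \<omega>\<^sup>2 + \<bar>c0\<bar> / \<omega>)"
  have "0 < \<omega>" by (simp add: \<omega>_def)
  then have "0 < C" by (auto simp: C_def intro!: mult_pos_pos add_pos_nonneg)
  have bounds:
    "ennreal \<bar>a - weighted_mean (ball c r) \<psi> v\<bar>
       \<le> ennreal (C * (1 - \<alpha>)) * double_kernel_integral (ball c r) \<alpha> v x" (is ?mean)
    "ennreal (C * (1 - \<alpha>)) * double_kernel_integral (ball c r) \<alpha> v x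
       \<le> ennreal (C * (1 - \<alpha>)) * riesz_kernel_integral (ball c r) \<alpha> v x" (is ?riesz)
    if \<alpha>: "0 < \<alpha>" "\<alpha> < 1" and r: "0 < r"
      and \<psi>: "in_Linf (ball c r) \<psi>" "AE y in lebesgue_on (ball c r). 0 \<le> \<psi> y"
        "L1_norm (ball c r) \<psi> = 1" "Linf_norm (ball c r) \<psi> \<le> ereal (c0 / r ^ CARD('n))"
      and v: "set_integrable lebesgue (ball c r) v"
      and x: "x \<in> closure (ball c r)" and lp: "lebesgue_point (ball c r) v x a"
    for \<alpha> r a :: real and c x :: "real^'n" and \<psi> v :: "real^'n \<Rightarrow> real"
  proof -
    let ?B = "ball c r"
    have B: "?B \<in> sets borel" by simp
    obtain g where g: "g \<in> borel_measurable borel" and int: "set_integrable lborel ?B g"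
      and ae: "AE y in lborel. y \<in> ?B \<longrightarrow> v y = g y"
      and means: "\<And>E a. E \<in> sets borel \<Longrightarrow> E \<subseteq> ?B \<Longrightarrow>
        (LINT y:E|lebesgue. \<bar>v y - a\<bar>) = (LINT y:E|lborel. \<bar>g y - a\<bar>)"
      using ex_borel_representative[OF v B] by blast
    have xr: "dist c x \<le> r" using x r by simp
    note to_lborel = nn_integral_lebesgue_eq_lborel_representative[OF ae]

    have double: "double_kernel_integral ?B \<alpha> v x =
        (\<integral>\<^sup>+z\<in>?B. (\<integral>\<^sup>+\<zeta>\<in>?B. ennreal (\<bar>g \<zeta> - g z\<bar> / (norm (\<zeta> - z) powr (real CARD('n) + \<alpha>) *
          (norm (x - z) + norm (x - \<zeta>)) powr (real CARD('n) - \<alpha>))) \<partial>lborel) \<partial>lborel)"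
      unfolding double_kernel_integral_def
      by (subst to_lborel[where H = "\<lambda>\<zeta> t. ennreal (\<bar>t - v z\<bar> / (norm (\<zeta> - z) powr (real CARD('n) + \<alpha>) *
            (norm (x - z) + norm (x - \<zeta>)) powr (real CARD('n) - \<alpha>)))" for z],
          rule to_lborel[where H = "\<lambda>z t. \<integral>\<^sup>+\<zeta>\<in>?B. ennreal (\<bar>g \<zeta> - t\<bar> / (norm (\<zeta> - z) powr (real CARD('n) + \<alpha>) *
            (norm (x - z) + norm (x - \<zeta>)) powr (real CARD('n) - \<alpha>))) \<partial>lborel"])
    have riesz: "riesz_kernel_integral ?B \<alpha> v x =
        (\<integral>\<^sup>+z\<in>?B. (\<integral>\<^sup>+\<zeta>\<in>?B. ennreal (\<bar>g \<zeta> - g z\<bar> / norm (\<zeta> - z) powr (real CARD('n) + \<alpha>)) \<partial>lborel) *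
          ennreal (1 / norm (x - z) powr (real CARD('n) - \<alpha>)) \<partial>lborel)"
      unfolding riesz_kernel_integral_def
      by (subst to_lborel[where H = "\<lambda>\<zeta> t. ennreal (\<bar>t - v z\<bar> / norm (\<zeta> - z) powr (real CARD('n) + \<alpha>))" for z],
          rule to_lborel[where H = "\<lambda>z t. (\<integral>\<^sup>+\<zeta>\<in>?B. ennreal (\<bar>g \<zeta> - t\<bar> / norm (\<zeta> - z) powr (real CARD('n) + \<alpha>)) \<partial>lborel) *
            ennreal (1 / norm (x - z) powr (real CARD('n) - \<alpha>))"])

    have "((\<lambda>\<rho>. (LINT y:(ball x \<rho> \<inter> ?B)|lborel. \<bar>g y - a\<bar>) / measure lborel (ball x \<rho> \<inter> ?B))
        \<longlongrightarrow> 0) (at_right 0)"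
      using lp by (simp add: lebesgue_point_def means)
    then have lim: "(\<lambda>k. average (shrunk_ball x c r k) g) \<longlonglongrightarrow> a"
      by (rule average_shrunk_ball_tendsto[OF g int r xr])
    have dev: "ennreal \<bar>u - weighted_mean ?B \<psi> v\<bar>
        \<le> ennreal (\<bar>c0\<bar> / r ^ DIM(real^'n)) * (\<integral>\<^sup>+y\<in>?B. ennreal \<bar>u - g y\<bar> \<partial>lborel)" for u
    proof -
      have "ennreal \<bar>u - weighted_mean ?B \<psi> v\<bar>
          \<le> ennreal (\<bar>c0\<bar> / r ^ CARD('n)) * (\<integral>\<^sup>+y\<in>?B. ennreal \<bar>u - v y\<bar> \<partial>lebesgue)"
        using r by (intro weighted_mean_deviation[OF _ v \<psi>]) (auto intro: divide_right_mono)
      also have "(\<integral>\<^sup>+y\<in>?B. ennreal \<bar>u - v y\<bar> \<partial>lebesgue) = (\<integral>\<^sup>+y\<in>?B. ennreal \<bar>u - g y\<bar> \<partial>lborel)"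
        by (rule to_lborel)
      finally show ?thesis by simp
    qed
    show ?mean
      using deviation_le_double_kernel[OF _ \<alpha> r xr g int lim abs_ge_zero dev] assms
      unfolding double C_def \<omega>_def by simp
    show ?riesz
      unfolding double riesz using g \<alpha> assms
      by (intro mult_left_mono riesz_kernel_dominates) auto
  qed
  show ?thesis
  proof (intro exI[of _ C] conjI allI impI; (elim conjE)?)
    show "0 < C" by fact
  qed (rule bounds; assumption)+
qed

end
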